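(* Let $\lambda\geq\omega$ be a cardinal, let $\langle n_i:i\in I\rangle\in\mathbb{N}^I$, and let $I_k:=\{i\in I:n_i=k\}$, for $k\in\mathbb{N}$. Then the tree $T=\dot{\bigcup}_{i\in I}\,{}^{<n_i}\lambda$ is reversible if and only if the sequence $\langle n_i:i\in I\rangle$ is (i) either finite-to-one (i.e. each $I_k$ is finite), (ii) or almost constant at some $k\in\mathbb{N}$ and bounded by $k$; that is, $$\exists k\in\mathbb{N}\;\Big(|I\setminus I_k|<\omega\;\land\;\forall i\in I\setminus I_k\;\; n_i<k\Big).$$
   Context: $\mathbb{N}$ is the set of positive integers. ${}^{<n}\lambda=\bigcup_{m<n}{}^{m}\lambda$ is the tree of all sequences in $\lambda$ of length $<n$, ordered by proper extension. $\dot{\bigcup}_{i\in I}T_i$ denotes the disjoint union of (disjoint copies of) the trees $T_i$; elements of different components are incomparable. A tree $T$ (as a strict partial order) is reversible iff every condensation of $T$, i.e. every bijection $f:T\to T$ such that $x<y$ implies $f(x)<f(y)$, is an automorphism of $T$. *)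

theory Defs
  imports Main "HOL-Library.Sublist"
begin

text \<open>
  A strict order is given by a carrier \<open>A\<close> and a relation \<open>lt\<close>,
  of which only the restriction to \<open>A\<close> matters; likewise for self-maps of \<open>A\<close>.
\<close>

definition condensation_on :: "'a set \<Rightarrow> ('a \<Rightarrow> 'a \<Rightarrow> bool) \<Rightarrow> ('a \<Rightarrow> 'a) \<Rightarrow> bool" where
  "condensation_on A lt f \<longleftrightarrow>
     bij_betw f A A \<and> (\<forall>x\<in>A. \<forall>y\<in>A. lt x y \<longrightarrow> lt (f x) (f y))"

definition automorphism_on :: "'a set \<Rightarrow> ('a \<Rightarrow> 'a \<Rightarrow> bool) \<Rightarrow> ('a \<Rightarrow> 'a) \<Rightarrow> bool" where
  "automorphism_on A lt f \<longleftrightarrow>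
     bij_betw f A A \<and> (\<forall>x\<in>A. \<forall>y\<in>A. lt x y \<longleftrightarrow> lt (f x) (f y))"

definition reversible_on :: "'a set \<Rightarrow> ('a \<Rightarrow> 'a \<Rightarrow> bool) \<Rightarrow> bool" where
  "reversible_on A lt \<longleftrightarrow> (\<forall>f. condensation_on A lt f \<longrightarrow> automorphism_on A lt f)"

text \<open>
  The tree of sequences in \<open>\<lambda>\<close> of length less than \<open>n\<close>; its order is
  \<^const>\<open>strict_prefix\<close>.  A cardinal is represented, as in the library of cardinals,
  by a cardinal order \<open>r\<close>, and its set of elements is \<open>Field r\<close>.
\<close>

definition seq_tree :: "'b rel \<Rightarrow> nat \<Rightarrow> 'b list set" where
  "seq_tree r n = (\<Union>m\<in>{..<n}. {s. length s = m \<and> set s \<subseteq> Field r})"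

text \<open>
  The carrier of the disjoint union of a family \<open>A\<close> over \<open>I\<close> is \<open>Sigma I A\<close>.
\<close>

definition disjoint_union_less ::
    "('i \<Rightarrow> 'a \<Rightarrow> 'a \<Rightarrow> bool) \<Rightarrow> 'i \<times> 'a \<Rightarrow> 'i \<times> 'a \<Rightarrow> bool" where
  "disjoint_union_less lt p q \<longleftrightarrow> fst p = fst q \<and> lt (fst p) (snd p) (snd q)"

end

theory Submission imports Defs begin

text \<open>
  The height of a component is its index \<open>n i\<close>.  Every maximal chain of a component has as
  many elements as the component is high, so a condensation can lower neither the level of a
  node nor the number of levels from it up to the top; hence it never maps a node into a
  component of smaller height.  The forest is reversible exactly when each component
  either has the largest height or is at least as high as only finitely many components
  (lemma \<open>finite_below_or_max_iff\<close> shows that this is the disjunction of the two cases).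

  If this holds, then a condensation preserves heights.  This is clear for components of largest
  height.  Otherwise, the roots of components of height at most \<open>m\<close> form a finite set which is
  closed under preimages, so the condensation permutes it and a root cannot be moved to a
  higher component (lemma \<open>seq_forest_reversible\<close>).  When heights are preserved, so are
  levels, and a condensation that preserves levels is an automorphism: the image of the unique
  node of given level below \<open>y\<close> is the unique node of that level below the image of \<open>y\<close>
  (lemma \<open>level_preserving_condensation_automorphism\<close>).

  If it fails, then infinitely many components have the same height \<open>k\<close> while some component
  is higher.  In the latter there is a node \<open>p\<close> each of whose children is the root of a copy of the
  tree of height \<open>k\<close>.  One component of height \<open>k\<close> is moved to sit above \<open>p\<close> as a further
  child; since \<open>p\<close> has infinitely many children and there are infinitely many components of
  height \<open>k\<close>, the rest of the forest can be shifted to make room for it and to fill the gap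
  (lemma \<open>seq_forest_not_reversible\<close>).  The result is a condensation that makes
  incomparable nodes comparable.
\<close>

section \<open>The forest and its condensations\<close>

abbreviation seq_forest :: "'b rel \<Rightarrow> 'i set \<Rightarrow> ('i \<Rightarrow> nat) \<Rightarrow> ('i \<times> 'b list) set" where
  "seq_forest r I n \<equiv> (SIGMA i:I. seq_tree r (n i))"

abbreviation forest_less :: "'i \<times> 'b list \<Rightarrow> 'i \<times> 'b list \<Rightarrow> bool" where
  "forest_less \<equiv> disjoint_union_less (\<lambda>_. strict_prefix)"

lemma mem_seq_tree_iff: "s \<in> seq_tree r m \<longleftrightarrow> length s < m \<and> set s \<subseteq> Field r"
  by (auto simp: seq_tree_def)

lemma forest_less_iff:
  "forest_less p q \<longleftrightarrow> fst p = fst q \<and> strict_prefix (snd p) (snd q)"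
  by (simp add: disjoint_union_less_def)

lemma condensation_mem:
  "condensation_on A lt f \<Longrightarrow> x \<in> A \<Longrightarrow> f x \<in> A"
  by (auto simp: condensation_on_def bij_betw_def)

lemma condensation_less:
  "condensation_on A lt f \<Longrightarrow> x \<in> A \<Longrightarrow> y \<in> A \<Longrightarrow> lt x y \<Longrightarrow> lt (f x) (f y)"
  by (auto simp: condensation_on_def)

text \<open>
  Consecutive nodes of a chain go to strictly increasing nodes of one component, so a chain
  occupies at least as many levels after the condensation as before.  Both monotonicity
  statements below follow: one from the chain that ends in a node, the other from a chain that
  starts in it and reaches the top level.
\<close>

lemma condensation_stretches:
  assumes f: "condensation_on (seq_forest r I n) forest_less f"
    and mem: "(i, s @ t) \<in> seq_forest r I n"
  shows "fst (f (i, s @ t)) = fst (f (i, s)) \<and>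
    length (snd (f (i, s))) + length t \<le> length (snd (f (i, s @ t)))"
  using mem
proof (induction t rule: rev_induct)
  case Nil
  then show ?case by simp
next
  case (snoc x t)
  have mem': "(i, s @ t) \<in> seq_forest r I n"
    using snoc.prems by (auto simp: mem_seq_tree_iff)
  have "forest_less (f (i, s @ t)) (f (i, s @ t @ [x]))"
    using condensation_less[OF f mem' snoc.prems]
    by (simp add: forest_less_iff strict_prefix_def)
  then show ?case
    using snoc.IH[OF mem'] prefix_length_less
    by (fastforce simp: forest_less_iff)
qed

lemma condensation_level_le:
  assumes f: "condensation_on (seq_forest r I n) forest_less f"
    and mem: "(i, s) \<in> seq_forest r I n"
  shows "length s \<le> length (snd (f (i, s)))"
  using condensation_stretches[OF f, of i "[]" s] mem by simp

lemma condensation_coheight_le: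
  assumes f: "condensation_on (seq_forest r I n) forest_less f"
    and mem: "(i, s) \<in> seq_forest r I n"
    and nonempty: "Field r \<noteq> {}"
  shows "n i + length (snd (f (i, s))) \<le> n (fst (f (i, s))) + length s"
proof -
  obtain a where a: "a \<in> Field r" using nonempty by blast
  define t where "t = replicate (n i - 1 - length s) a"
  have len: "length s < n i" using mem by (auto simp: mem_seq_tree_iff)
  have st: "(i, s @ t) \<in> seq_forest r I n"
    using mem a by (auto simp: mem_seq_tree_iff t_def)
  have "length (snd (f (i, s @ t))) < n (fst (f (i, s @ t)))"
    using condensation_mem[OF f st] by (auto simp: mem_seq_tree_iff)
  then show ?thesis
    using condensation_stretches[OF f st] len by (auto simp: t_def)
qed

lemma condensation_height_le:
  assumes "condensation_on (seq_forest r I n) forest_less f"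
    and "(i, s) \<in> seq_forest r I n" and "Field r \<noteq> {}"
  shows "n i \<le> n (fst (f (i, s)))"
  using condensation_level_le[OF assms(1,2)] condensation_coheight_le[OF assms] by linarith

text \<open>
  To reflect a comparison \<open>f x < f y\<close>, consider the node \<open>z\<close> below \<open>y\<close> that has the level
  of \<open>x\<close>: then \<open>f z\<close> and \<open>f x\<close> are both below \<open>f y\<close> on the same level, so they are equal.
\<close>

lemma level_preserving_condensation_automorphism:
  assumes f: "condensation_on (seq_forest r I n) forest_less f"
    and level: "\<And>x. x \<in> seq_forest r I n \<Longrightarrow> length (snd (f x)) = length (snd x)"
  shows "automorphism_on (seq_forest r I n) forest_less f"
proof -
  let ?A = "seq_forest r I n"
  have bij: "bij_betw f ?A ?A" using f by (simp add: condensation_on_def)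
  have "forest_less x y" if x: "x \<in> ?A" and y: "y \<in> ?A" and less: "forest_less (f x) (f y)" for x y
  proof -
    define z where "z = (fst y, take (length (snd x)) (snd y))"
    have len: "length (snd x) < length (snd y)"
      using prefix_length_less less level[OF x] level[OF y] by (metis forest_less_iff)
    have z: "z \<in> ?A"
      using y len by (auto simp: z_def mem_seq_tree_iff subset_iff dest: in_set_takeD)
    have zy: "forest_less z y"
      using len append_take_drop_id[of "length (snd x)" "snd y"]
      unfolding z_def forest_less_iff fst_conv snd_conv
      by (metis strict_prefixI' take_is_prefix length_take min_less_iff_conj less_irrefl strict_prefix_def)
    have "forest_less (f z) (f y)"
      by (rule condensation_less[OF f z y zy])
    moreover have "length (snd (f z)) = length (snd (f x))"
      using level[OF x] level[OF z] len by (simp add: z_def)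
    ultimately have "f z = f x"
      using less unfolding forest_less_iff strict_prefix_def prefix_def
      by (metis append_eq_append_conv prod.expand)
    then have "z = x"
      using bij x z by (auto simp: bij_betw_def inj_on_def)
    with zy show ?thesis by simp
  qed
  then show ?thesis
    using f by (auto simp: automorphism_on_def condensation_on_def)
qed

section \<open>Forests whose condensations preserve heights\<close>

lemma bij_betw_image_eq_if_vimage_subset:
  assumes bij: "bij_betw f A A" and R: "finite R" "R \<subseteq> A"
    and closed: "\<And>x. x \<in> A \<Longrightarrow> f x \<in> R \<Longrightarrow> x \<in> R"
  shows "f ` R = R"
proof -
  have "R \<subseteq> f ` R"
  proof
    fix y assume y: "y \<in> R"
    then obtain x where "x \<in> A" "y = f x"
      using R(2) bij_betw_imp_surj_on[OF bij] by (metis imageE subsetD)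
    with y closed show "y \<in> f ` R" by blast
  qed
  moreover have "card (f ` R) \<le> card R"
    using R(1) by (rule card_image_le)
  ultimately show ?thesis
    using R(1) by (metis card_seteq finite_imageI)
qed

text \<open>
  Only the roots need attention, because all nodes of a component follow their root.  A
  condensation never lowers heights, so it suffices that it does not raise the height at a root.
\<close>

lemma seq_forest_reversible:
  fixes n :: "'i \<Rightarrow> nat"
  assumes nonempty: "Field r \<noteq> {}"
    and cond: "\<forall>i\<in>I. finite {j \<in> I. n j \<le> n i} \<or> (\<forall>j\<in>I. n j \<le> n i)"
  shows "reversible_on (seq_forest r I n) forest_less"
  unfolding reversible_on_def
proof (intro allI impI)
  fix f
  let ?A = "seq_forest r I n"
  assume f: "condensation_on ?A forest_less f"
  have bij: "bij_betw f ?A ?A" using f by (simp add: condensation_on_def)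
  have root_height: "n (fst (f (i, []))) \<le> n i" if root: "(i, []) \<in> ?A" for i
  proof (cases "finite {j \<in> I. n j \<le> n i}")
    case False
    then show ?thesis
      using cond root condensation_mem[OF f root] by auto
  next
    case True
    define R where "R = ({j \<in> I. n j \<le> n i} \<times> {[]}) \<inter> ?A"
    have "f ` R = R"
    proof (rule bij_betw_image_eq_if_vimage_subset[OF bij])
      show "finite R" using True by (simp add: R_def)
      show "R \<subseteq> ?A" by (simp add: R_def)
      fix x assume x: "x \<in> ?A" and fx: "f x \<in> R"
      obtain j s where js: "x = (j, s)" by (cases x)
      \<comment> \<open>Neither level nor height drops, so only a root of height at most \<open>n i\<close> can be sent to one.\<close>
      show "x \<in> R"
        using condensation_level_le[OF f, of j s] condensation_height_le[OF f, of j s] x fx nonempty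
        by (auto simp: R_def js)
    qed
    moreover have "(i, []) \<in> R" using root by (auto simp: R_def)
    ultimately have "f (i, []) \<in> R" by blast
    then show ?thesis by (auto simp: R_def)
  qed
  show "automorphism_on ?A forest_less f"
  proof (rule level_preserving_condensation_automorphism[OF f])
    fix x assume x: "x \<in> ?A"
    obtain i s where x_eq: "x = (i, s)" by (cases x)
    have root: "(i, []) \<in> ?A" using x by (auto simp: x_eq mem_seq_tree_iff)
    have "fst (f (i, s)) = fst (f (i, []))"
      using condensation_stretches[OF f, of i "[]" s] x by (simp add: x_eq)
    then have "n (fst (f (i, s))) \<le> n i" using root_height[OF root] by simp
    then show "length (snd (f x)) = length (snd x)"
      using condensation_level_le[OF f, of i s] condensation_coheight_le[OF f, of i s] x nonempty
      by (simp add: x_eq)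
  qed
qed

section \<open>Grafting a component onto a higher one\<close>

text \<open>
  The map \<open>g\<close> moves the children of the node \<open>p\<close>, together with the subtrees above them.
  Updating a list at its length changes nothing, so \<open>p\<close> itself stays fixed.
\<close>

definition relabel_after :: "'b list \<Rightarrow> ('b \<Rightarrow> 'b) \<Rightarrow> 'b list \<Rightarrow> 'b list" where
  "relabel_after p g s = (if prefix p s then s[length p := g (s ! length p)] else s)"

lemma relabel_after_append: "relabel_after p g (p @ x # t) = p @ g x # t"
  by (simp add: relabel_after_def)

lemma relabel_after_other: "\<nexists>x t. s = p @ x # t \<Longrightarrow> relabel_after p g s = s"
  by (auto simp: relabel_after_def prefix_def) (metis append_Nil2 list.exhaust list_update_beyond order_refl)

lemma relabel_after_mono:
  assumes "strict_prefix s s'"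
  shows "strict_prefix (relabel_after p g s) (relabel_after p g s')"
proof (cases "\<exists>x t. s = p @ x # t")
  case True
  then show ?thesis
    using assms by (auto simp: strict_prefix_def prefix_def relabel_after_append)
next
  case s: False
  show ?thesis
  proof (cases "\<exists>x t. s' = p @ x # t")
    case True
    then obtain x t where s': "s' = p @ x # t" by blast
    have "prefix s p"
    proof -
      have "prefix s (p @ x # t)" using assms s' by (simp add: strict_prefix_def)
      then show ?thesis using s by (auto simp: prefix_append prefix_Cons)
    qed
    then have "strict_prefix s (p @ g x # t)"
      by (auto simp: strict_prefix_def prefix_def)
    then show ?thesis by (simp add: s' relabel_after_append relabel_after_other[OF s])
  next
    case False
    then show ?thesis using assms by (simp add: relabel_after_other s)
  qed
qed

text \<open>
  Shifting the children of \<open>p\<close> off the label \<open>a\<close> vacates exactly one subtree.  The height of the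
  tree is chosen so that this subtree has height \<open>k\<close>.
\<close>

lemma bij_betw_relabel_after:
  assumes g: "bij_betw g (Field r) (Field r - {a})"
  shows "bij_betw (relabel_after p g) (seq_tree r (Suc (length p + k)))
    (seq_tree r (Suc (length p + k)) - (\<lambda>s. p @ a # s) ` seq_tree r k)"
    (is "bij_betw ?f ?T (?T - ?S)")
proof (rule bij_betw_byWitness[where f' = "relabel_after p (inv_into (Field r) g)"])
  let ?h = "inv_into (Field r) g"
  have h: "\<And>x. x \<in> Field r \<Longrightarrow> ?h (g x) = x" "\<And>x. x \<in> Field r - {a} \<Longrightarrow> g (?h x) = x"
    "\<And>x. x \<in> Field r - {a} \<Longrightarrow> ?h x \<in> Field r"
    using g bij_betw_inv_into_left bij_betw_inv_into_right bij_betw_apply bij_betw_inv_into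
    by metis+
  have S_iff: "p @ x # t \<in> ?S \<longleftrightarrow> x = a \<and> t \<in> seq_tree r k" for x t
    by auto
  have gF: "g x \<in> Field r - {a}" if "x \<in> Field r" for x
    using bij_betw_apply[OF g that] .
  show "\<forall>s\<in>?T. relabel_after p ?h (?f s) = s"
  proof
    fix s assume s: "s \<in> ?T"
    show "relabel_after p ?h (?f s) = s"
      by (cases "\<exists>x t. s = p @ x # t")
        (use s h in \<open>auto simp: relabel_after_append relabel_after_other mem_seq_tree_iff\<close>)
  qed
  show "\<forall>s\<in>?T - ?S. ?f (relabel_after p ?h s) = s"
  proof
    fix s assume s: "s \<in> ?T - ?S"
    show "?f (relabel_after p ?h s) = s"
      by (cases "\<exists>x t. s = p @ x # t")
        (use s h in \<open>auto simp: relabel_after_append relabel_after_other S_iff mem_seq_tree_iff\<close>)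
  qed
  show "?f ` ?T \<subseteq> ?T - ?S"
  proof (rule image_subsetI)
    fix s assume s: "s \<in> ?T"
    show "?f s \<in> ?T - ?S"
      by (cases "\<exists>x t. s = p @ x # t")
        (use s gF in \<open>auto simp: relabel_after_append relabel_after_other S_iff mem_seq_tree_iff\<close>)
  qed
  show "relabel_after p ?h ` (?T - ?S) \<subseteq> ?T"
  proof (rule image_subsetI)
    fix s assume s: "s \<in> ?T - ?S"
    show "relabel_after p ?h s \<in> ?T"
      by (cases "\<exists>x t. s = p @ x # t")
        (use s h in \<open>auto simp: relabel_after_append relabel_after_other S_iff mem_seq_tree_iff\<close>)
  qed
qed

text \<open>
  The component \<open>m\<close> of height \<open>k\<close> is grafted onto a node \<open>p\<close> of the higher component \<open>l\<close>,
  as the subtree above a new child \<open>a\<close>.  Two shifts of infinite sets restore the forest: \<open>g\<close>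
  frees the label \<open>a\<close>, and \<open>c\<close> refills the place of \<open>m\<close> with the other components of
  height \<open>k\<close>.  The root of \<open>m\<close> has become comparable with \<open>p\<close>.
\<close>

lemma seq_forest_not_reversible:
  fixes n :: "'i \<Rightarrow> nat"
  assumes inf: "infinite (Field r)" and infk: "infinite {i \<in> I. n i = k}" and k: "k \<ge> 1"
    and l: "l \<in> I" "k < n l"
  shows "\<not> reversible_on (seq_forest r I n) forest_less"
proof -
  let ?A = "seq_forest r I n" and ?K = "{i \<in> I. n i = k}"
  obtain m where m: "m \<in> ?K" using infinite_imp_nonempty[OF infk] by blast
  obtain c where c: "bij_betw c (?K - {m}) ?K"
    using infinite_imp_bij_betw[OF infk] bij_betw_inv by blast
  obtain a where a: "a \<in> Field r" using infinite_imp_nonempty[OF inf] by blast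
  obtain g where g: "bij_betw g (Field r) (Field r - {a})"
    using infinite_imp_bij_betw[OF inf] by blast
  \<comment> \<open>On the level of \<open>p\<close>, exactly \<open>k\<close> levels of the component \<open>l\<close> remain above.\<close>
  define p where "p = replicate (n l - k - 1) a"
  have p: "set p \<subseteq> Field r" using a by (auto simp: p_def)
  have nl: "n l = Suc (length p + k)" using l by (simp add: p_def)
  define d where "d i = (if n i = k then c i else i)" for i
  define f where "f = (\<lambda>(i, s).
    if i = m then (l, p @ a # s) else if i = l then (l, relabel_after p g s) else (d i, s))"
  have cK: "c i \<in> ?K" if "i \<in> ?K - {m}" for i
    using bij_betw_apply[OF c that] .
  have lm: "l \<noteq> m" using m l by auto
  have d: "bij_betw d (I - {m, l}) (I - {l})"
  proof -
    have "bij_betw d (?K - {m}) ?K"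
      using c by (rule bij_betw_cong[THEN iffD1, rotated]) (simp add: d_def)
    moreover have "bij_betw d ({i \<in> I. n i \<noteq> k} - {l}) ({i \<in> I. n i \<noteq> k} - {l})"
      by (rule bij_betw_cong[THEN iffD1, OF _ bij_betw_id]) (simp add: d_def)
    ultimately have "bij_betw d ((?K - {m}) \<union> ({i \<in> I. n i \<noteq> k} - {l})) (?K \<union> ({i \<in> I. n i \<noteq> k} - {l}))"
      by (rule bij_betw_combine) auto
    moreover have "(?K - {m}) \<union> ({i \<in> I. n i \<noteq> k} - {l}) = I - {m, l}"
      "?K \<union> ({i \<in> I. n i \<noteq> k} - {l}) = I - {l}"
      using m l by auto
    ultimately show ?thesis by simp
  qed
  have nd: "n (d i) = n i" if "i \<in> I - {m}" for i
    using cK[of i] that by (auto simp: d_def)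
  define S where "S = (\<lambda>s. p @ a # s) ` seq_tree r k"
  have S_sub: "S \<subseteq> seq_tree r (n l)"
    using p a by (auto simp: S_def mem_seq_tree_iff nl)
  have f_m: "bij_betw f ({m} \<times> seq_tree r k) ({l} \<times> S)"
    by (auto simp: bij_betw_def f_def inj_on_def image_iff S_def)
  have f_l: "bij_betw f ({l} \<times> seq_tree r (n l)) ({l} \<times> (seq_tree r (n l) - S))"
  proof -
    have "bij_betw (map_prod id (relabel_after p g))
        ({l} \<times> seq_tree r (n l)) ({l} \<times> (seq_tree r (n l) - S))"
      unfolding nl S_def by (intro bij_betw_map_prod bij_betw_relabel_after g) simp
    then show ?thesis
      by (rule bij_betw_cong[THEN iffD1, rotated]) (use lm in \<open>auto simp: f_def\<close>)
  qed
  have f_ml: "bij_betw f ({m} \<times> seq_tree r k \<union> {l} \<times> seq_tree r (n l))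
      ({l} \<times> S \<union> {l} \<times> (seq_tree r (n l) - S))"
    by (rule bij_betw_combine[OF f_m f_l]) blast
  have f_rest: "bij_betw f (seq_forest r (I - {m, l}) n) (seq_forest r (I - {l}) n)"
  proof -
    have "inj_on f (seq_forest r (I - {m, l}) n)"
    proof (rule inj_onI)
      fix x y
      assume xy: "x \<in> seq_forest r (I - {m, l}) n" "y \<in> seq_forest r (I - {m, l}) n" "f x = f y"
      then have "d (fst x) = d (fst y)" "snd x = snd y"
        by (auto simp: f_def split: prod.splits if_splits)
      moreover have "fst x \<in> I - {m, l}" "fst y \<in> I - {m, l}" using xy by auto
      ultimately show "x = y"
        using inj_onD[OF bij_betw_imp_inj_on[OF d]] by (blast intro: prod_eqI)
    qed
    moreover have "f ` seq_forest r (I - {m, l}) n = seq_forest r (I - {l}) n"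
    proof (intro equalityI subsetI)
      fix x assume "x \<in> f ` seq_forest r (I - {m, l}) n"
      then show "x \<in> seq_forest r (I - {l}) n"
        using nd bij_betw_apply[OF d] by (auto simp: f_def split: if_splits)
    next
      fix x assume x: "x \<in> seq_forest r (I - {l}) n"
      obtain j s where js: "x = (j, s)" by (cases x)
      then have "j \<in> d ` (I - {m, l})"
        using x bij_betw_imp_surj_on[OF d] by (simp add: js)
      then obtain i where "i \<in> I - {m, l}" "d i = j" by blast
      then have "x = f (i, s)" "(i, s) \<in> seq_forest r (I - {m, l}) n"
        using x nd[of i] by (auto simp: js f_def)
      then show "x \<in> f ` seq_forest r (I - {m, l}) n" by blast
    qed
    ultimately show ?thesis by (simp add: bij_betw_def)
  qed
  have "bij_betw f
      (({m} \<times> seq_tree r k \<union> {l} \<times> seq_tree r (n l)) \<union> seq_forest r (I - {m, l}) n)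
      (({l} \<times> S \<union> {l} \<times> (seq_tree r (n l) - S)) \<union> seq_forest r (I - {l}) n)"
    by (rule bij_betw_combine[OF f_ml f_rest]) blast
  moreover have "({m} \<times> seq_tree r k \<union> {l} \<times> seq_tree r (n l)) \<union> seq_forest r (I - {m, l}) n = ?A"
    using m l by auto
  moreover have "({l} \<times> S \<union> {l} \<times> (seq_tree r (n l) - S)) \<union> seq_forest r (I - {l}) n = ?A"
    using l(1) S_sub by blast
  ultimately have bij: "bij_betw f ?A ?A" by simp
  have graft_less: "strict_prefix (p @ a # s) (p @ a # t) \<longleftrightarrow> strict_prefix s t" for s t
    by (simp add: strict_prefix_def)
  have "forest_less (f x) (f y)" if "forest_less x y" for x y
    using that
    by (auto simp: forest_less_iff f_def graft_less relabel_after_mono split: prod.splits)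
  then have "condensation_on ?A forest_less f"
    using bij by (simp add: condensation_on_def)
  moreover have "\<not> automorphism_on ?A forest_less f"
  proof -
    have "f (l, p) = (l, p)" "f (m, []) = (l, p @ [a])"
      using lm by (simp_all add: f_def relabel_after_other)
    then have "forest_less (f (l, p)) (f (m, []))" "\<not> forest_less (l, p) (m, [])"
      by (auto simp: forest_less_iff strict_prefix_def)
    moreover have "(l, p) \<in> ?A" "(m, []) \<in> ?A"
      using l m k p nl by (auto simp: mem_seq_tree_iff)
    ultimately show ?thesis by (auto simp: automorphism_on_def)
  qed
  ultimately show ?thesis by (auto simp: reversible_on_def)
qed

section \<open>Families of heights and the characterisation\<close>

lemma infinite_fibre_below:
  fixes n :: "'i \<Rightarrow> nat"
  assumes "infinite {j \<in> I. n j \<le> m}"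
  obtains k where "k \<le> m" "infinite {j \<in> I. n j = k}"
proof -
  have "{j \<in> I. n j \<le> m} = (\<Union>k\<in>{..m}. {j \<in> I. n j = k})" by auto
  then show ?thesis using assms that by (metis (no_types, lifting) atMost_iff finite_UN_I finite_atMost)
qed

text \<open>
  If some height \<open>k\<close> is taken infinitely often, the condition at a component of height \<open>k\<close>
  makes \<open>k\<close> the largest height, and the condition at lower components allows each of the
  finitely many smaller heights only finitely often.
\<close>

lemma finite_below_or_max_iff:
  fixes n :: "'i \<Rightarrow> nat"
  assumes pos: "\<forall>i\<in>I. n i \<ge> 1"
  shows "(\<forall>i\<in>I. finite {j \<in> I. n j \<le> n i} \<or> (\<forall>j\<in>I. n j \<le> n i)) \<longleftrightarrow>
    (\<forall>k\<ge>1. finite {i \<in> I. n i = k})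
      \<or> (\<exists>k\<ge>1. finite (I - {i \<in> I. n i = k}) \<and> (\<forall>i\<in>I - {i \<in> I. n i = k}. n i < k))"
    (is "?C \<longleftrightarrow> ?fin \<or> ?max")
proof
  assume C: ?C
  show "?fin \<or> ?max"
  proof (cases ?fin)
    case False
    then obtain k where k: "k \<ge> 1" and inf: "infinite {i \<in> I. n i = k}" by blast
    obtain i where i: "i \<in> I" "n i = k" using infinite_imp_nonempty[OF inf] by blast
    have "infinite {j \<in> I. n j \<le> n i}"
      using inf by (rule contrapos_nn) (rule finite_subset[rotated], use i in auto)
    then have max: "\<forall>j\<in>I. n j \<le> k" using C i by auto
    have "finite {j \<in> I. n j \<le> k - 1}"
    proof (rule ccontr)
      assume "infinite {j \<in> I. n j \<le> k - 1}"
      then obtain h where h: "h \<le> k - 1" "infinite {j \<in> I. n j = h}"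
        by (rule infinite_fibre_below)
      obtain j where j: "j \<in> I" "n j = h" using infinite_imp_nonempty[OF h(2)] by blast
      have "infinite {j' \<in> I. n j' \<le> n j}"
        using h(2) by (rule contrapos_nn) (rule finite_subset[rotated], use j in auto)
      then have "k \<le> h" using C i j by auto
      then show False using h(1) k by simp
    qed
    moreover have "I - {i \<in> I. n i = k} = {j \<in> I. n j \<le> k - 1}"
      using max k by fastforce
    ultimately have "finite (I - {i \<in> I. n i = k})" by (simp only:)
    moreover have "\<forall>i\<in>I - {i \<in> I. n i = k}. n i < k" using max by force
    ultimately have ?max using k by blast
    then show ?thesis ..
  qed simp
next
  assume "?fin \<or> ?max"
  then show ?C
  proof
    assume fin: ?fin
    show ?C
    proof (rule ballI, rule disjI1, rule ccontr)
      fix i assume "infinite {j \<in> I. n j \<le> n i}"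
      then obtain k where k: "infinite {j \<in> I. n j = k}" by (rule infinite_fibre_below)
      obtain j where "j \<in> I" "n j = k" using infinite_imp_nonempty[OF k] by blast
      then show False using fin k pos by auto
    qed
  next
    assume ?max
    then obtain k where fin: "finite (I - {i \<in> I. n i = k})"
      and lt: "\<forall>i\<in>I - {i \<in> I. n i = k}. n i < k" by blast
    show ?C
    proof
      fix i assume i: "i \<in> I"
      show "finite {j \<in> I. n j \<le> n i} \<or> (\<forall>j\<in>I. n j \<le> n i)"
      proof (cases "n i = k")
        case True
        have "n j \<le> n i" if "j \<in> I" for j
          using lt that True by (cases "n j = k") (auto intro: less_imp_le)
        then show ?thesis by blast
      next
        case False
        then have "n i < k" using lt i by blast
        then show ?thesis by (intro disjI1 finite_subset[OF _ fin]) auto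
      qed
    qed
  qed
qed

theorem theorem6p4:
  fixes lam :: "'b rel" and I :: "'i set" and n :: "'i \<Rightarrow> nat"
  assumes "Card_order lam" and "(natLeq, lam) \<in> ordLeq"
    and "\<forall>i\<in>I. n i \<ge> 1"
  shows "reversible_on (SIGMA i:I. seq_tree lam (n i)) (disjoint_union_less (\<lambda>_. strict_prefix))
    \<longleftrightarrow> (\<forall>k\<ge>1. finite {i \<in> I. n i = k})
      \<or> (\<exists>k\<ge>1. finite (I - {i \<in> I. n i = k}) \<and> (\<forall>i\<in>I - {i \<in> I. n i = k}. n i < k))"
proof -
  have "(natLeq, card_of (Field lam)) \<in> ordLeq"
    using assms(1,2) card_of_Field_ordIso ordIso_symmetric ordLeq_ordIso_trans by blast
  then have inf: "infinite (Field lam)" using infinite_iff_natLeq_ordLeq by blast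
  have "reversible_on (seq_forest lam I n) forest_less \<longleftrightarrow>
    (\<forall>i\<in>I. finite {j \<in> I. n j \<le> n i} \<or> (\<forall>j\<in>I. n j \<le> n i))" (is "?rev \<longleftrightarrow> ?C")
  proof
    assume ?C
    then show ?rev using inf by (intro seq_forest_reversible) auto
  next
    assume rev: ?rev
    show ?C
    proof (rule ccontr)
      assume "\<not> ?C"
      then obtain i l where i: "infinite {j \<in> I. n j \<le> n i}" and l: "l \<in> I" "n i < n l"
        by (auto simp: not_le)
      obtain k where k: "k \<le> n i" "infinite {j \<in> I. n j = k}"
        using i by (rule infinite_fibre_below)
      obtain j where "j \<in> I" "n j = k" using infinite_imp_nonempty[OF k(2)] by blast
      then have "k \<ge> 1" using assms(3) by auto
      with rev show False
        using seq_forest_not_reversible[OF inf k(2) _ l(1)] k(1) l(2) by simp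
    qed
  qed
  then show ?thesis using finite_below_or_max_iff[OF assms(3)] by simp
qed

end
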